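(* Let $U\subseteq \mathcal{C}^m$ be an $\mathfrak{m}$-adic neighbourhood of $0$ and let $f\colon U\to \mathcal{C}^m$ be a textile map with $f(0)=0$. Assume that $f=\ell+h$ and $f(U)\subseteq W$, where $W\subseteq\mathcal{C}^m$ is a neighbourhood of $0$ and $\ell\colon U\to W$ is linear, textile and invertible, i.e. there exists a linear map $\tilde\ell\colon W\to U$ with $\ell\circ\tilde\ell=\mathrm{id}_W$ and $\tilde\ell\circ\ell=\mathrm{id}_U$. If $\tilde\ell\circ h$ is contractive on $U$, then $f$ admits an inverse on $U$.
   Context: Let $k$ be a field of characteristic $0$, $n\ge 1$. A cord is a family $c=(c_\alpha)_{\alpha\in\mathbb{N}^n}$ of elements of $k$ ($\mathbb N\ni 0$); the space $\mathcal{C}$ of cords is identified with $k[[x_1,\dots,x_n]]$ via $c\mapsto\sum_\alpha c_\alpha x^\alpha$. $\mathfrak{m}$ is the maximal ideal of $k[[x_1,\dots,x_n]]$. For $c=(c^1,\dots,c^m)\in\mathcal{C}^m$, $\mathrm{ord}\,c$ is the minimum of the orders of the power series $c^i$ ($\mathrm{ord}\,0=\infty$). $\mathcal{C}^m$ carries the $\mathfrak{m}$-adic topology with basic neighbourhoods of $0$ given by $\mathfrak{m}^l\cdot\mathcal{C}^m$, $l\in\mathbb{N}$. The neighbourhoods $U,W$ of $0$ on which linear maps are considered are $k$-linear subspaces containing some $\mathfrak{m}^l\cdot\mathcal{C}^m$. A map $\mathcal{C}^m\to\mathcal{C}^p$ is textile if every coefficient of the image of $c$ is a polynomial over $k$ (in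 finitely many variables) in the coefficients of $c$. For $U\subseteq\mathcal{C}^m$, a map $U\to\mathcal{C}^p$ is textile if it is the restriction to $U$ of a textile map $\mathcal{C}^m\to\mathcal{C}^p$. A map $g\colon U\to\mathcal{C}^p$ is contractive on $U$ if $\mathrm{ord}(g(a)-g(b))>\mathrm{ord}(a-b)$ for all $a\ne b$ in $U$. That $f$ admits an inverse on $U$ means: there is a textile map $g\colon f(U)\to U$ with $f\circ g=\mathrm{id}_{f(U)}$ and $g\circ f=\mathrm{id}_U$. *)

theory Defs
  imports "HOL-Analysis.Finite_Cartesian_Product" "HOL-Library.Poly_Mapping"
    "HOL-Library.Extended_Nat"
begin

text \<open>
  Exponents in \<open>\<nat>\<^sup>n\<close> are vectors of type \<open>nat ^ 'n\<close>. A finite index type is nonempty, so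
  \<open>n \<ge> 1\<close> holds automatically. A cord is identified with the power series having it as
  coefficient family, so the ring structure on cords is that of \<open>k[[x\<^sub>1, \<dots>, x\<^sub>n]]\<close>.
\<close>

typedef ('k, 'n) cord = "UNIV :: ((nat ^ 'n::finite) \<Rightarrow> 'k) set"
  morphisms coeff Cord ..

setup_lifting type_definition_cord

lemma cord_eqI: "(\<And>\<alpha>. coeff f \<alpha> = coeff g \<alpha>) \<Longrightarrow> f = g"
  by (metis coeff_inject ext)

text \<open>The pairs of exponents entering the \<open>\<alpha>\<close>-th coefficient of the Cauchy product.\<close>

definition antidiag :: "nat ^ 'n::finite \<Rightarrow> ((nat ^ 'n) \<times> (nat ^ 'n)) set" where
  "antidiag \<alpha> = {(\<beta>, \<gamma>). \<beta> + \<gamma> = \<alpha>}"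

lemma finite_antidiag [simp]: "finite (antidiag \<alpha>)"
proof -
  let ?B = "{\<beta> :: nat ^ 'a. \<forall>i. \<beta> $ i \<le> \<alpha> $ i}"
  have "finite (vec_nth ` ?B)"
    by (rule finite_subset[of _ "PiE UNIV (\<lambda>i. {..\<alpha> $ i})"]) (auto intro: finite_PiE)
  then have "finite ?B"
    by (rule finite_imageD) (auto simp: inj_on_def vec_eq_iff)
  moreover have "antidiag \<alpha> \<subseteq> ?B \<times> ?B"
    by (auto simp: antidiag_def)
  ultimately show ?thesis
    by (meson finite_SigmaI finite_subset)
qed

instantiation cord :: (comm_ring_1, finite) comm_ring_1
begin

lift_definition zero_cord :: "('a, 'b) cord" is "\<lambda>_. 0" .
lift_definition one_cord :: "('a, 'b) cord" is "\<lambda>\<alpha>. if \<alpha> = 0 then 1 else 0" .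
lift_definition plus_cord :: "('a, 'b) cord \<Rightarrow> ('a, 'b) cord \<Rightarrow> ('a, 'b) cord"
  is "\<lambda>f g \<alpha>. f \<alpha> + g \<alpha>" .
lift_definition minus_cord :: "('a, 'b) cord \<Rightarrow> ('a, 'b) cord \<Rightarrow> ('a, 'b) cord"
  is "\<lambda>f g \<alpha>. f \<alpha> - g \<alpha>" .
lift_definition uminus_cord :: "('a, 'b) cord \<Rightarrow> ('a, 'b) cord"
  is "\<lambda>f \<alpha>. - f \<alpha>" .
lift_definition times_cord :: "('a, 'b) cord \<Rightarrow> ('a, 'b) cord \<Rightarrow> ('a, 'b) cord"
  is "\<lambda>f g \<alpha>. \<Sum>(\<beta>, \<gamma>)\<in>antidiag \<alpha>. f \<beta> * g \<gamma>" .

instance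
proof
  fix a b c :: "('a, 'b) cord"
  show "a + b + c = a + (b + c)" by transfer (simp add: algebra_simps)
  show "a + b = b + a" by transfer (simp add: algebra_simps)
  show "0 + a = a" by transfer simp
  show "- a + a = 0" by transfer simp
  show "a - b = a + - b" by transfer simp
  show "(0::('a, 'b) cord) \<noteq> 1" by transfer (metis one_neq_zero)
  show "(a + b) * c = a * c + b * c"
    by transfer (simp add: algebra_simps sum.distrib case_prod_unfold)
  show "a * b = b * a"
  proof (rule cord_eqI)
    fix \<alpha>
    show "coeff (a * b) \<alpha> = coeff (b * a) \<alpha>"
      unfolding times_cord.rep_eq
      by (rule sum.reindex_bij_witness[of _ prod.swap prod.swap])
        (auto simp: antidiag_def algebra_simps)
  qed
  show "1 * a = a"
  proof (rule cord_eqI)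
    fix \<alpha> :: "nat ^ 'b"
    have "coeff (1 * a) \<alpha> = (\<Sum>p\<in>antidiag \<alpha>. if p = (0, \<alpha>) then coeff a \<alpha> else 0)"
      unfolding times_cord.rep_eq one_cord.rep_eq
      by (rule sum.cong) (auto simp: antidiag_def split: if_splits)
    also have "\<dots> = coeff a \<alpha>"
      by (subst sum.delta) (auto, simp add: antidiag_def)
    finally show "coeff (1 * a) \<alpha> = coeff a \<alpha>" .
  qed
  show "a * b * c = a * (b * c)"
  proof (rule cord_eqI)
    fix \<alpha> :: "nat ^ 'b"
    have "coeff (a * b * c) \<alpha> =
        (\<Sum>p\<in>antidiag \<alpha>. \<Sum>q\<in>antidiag (fst p). coeff a (fst q) * coeff b (snd q) * coeff c (snd p))"
      unfolding times_cord.rep_eq by (simp add: case_prod_unfold sum_distrib_right)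
    also have "\<dots> = (\<Sum>(p, q)\<in>Sigma (antidiag \<alpha>) (\<lambda>p. antidiag (fst p)).
        coeff a (fst q) * coeff b (snd q) * coeff c (snd p))"
      by (rule sum.Sigma) auto
    also have "\<dots> = (\<Sum>(p, q)\<in>Sigma (antidiag \<alpha>) (\<lambda>p. antidiag (snd p)).
        coeff a (fst p) * (coeff b (fst q) * coeff c (snd q)))"
      by (rule sum.reindex_bij_witness[of _
            "\<lambda>(p, q). ((fst p + fst q, snd q), (fst p, fst q))"
            "\<lambda>(p, q). ((fst q, snd q + snd p), (snd q, snd p))"])
        (auto simp: antidiag_def algebra_simps)
    also have "\<dots> = (\<Sum>p\<in>antidiag \<alpha>. \<Sum>q\<in>antidiag (snd p).
        coeff a (fst p) * (coeff b (fst q) * coeff c (snd q)))"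
      by (rule sum.Sigma[symmetric]) auto
    also have "\<dots> = coeff (a * (b * c)) \<alpha>"
      unfolding times_cord.rep_eq by (simp add: case_prod_unfold sum_distrib_left)
    finally show "coeff (a * b * c) \<alpha> = coeff (a * (b * c)) \<alpha>" .
  qed
qed

end

definition vscale :: "'k::comm_ring_1 \<Rightarrow> ('k, 'n::finite) cord ^ 'm \<Rightarrow> ('k, 'n) cord ^ 'm" where
  "vscale a c = (\<chi> i. Cord (\<lambda>\<alpha>. a * coeff (c $ i) \<alpha>))"

interpretation cords: vector_space "vscale :: 'k::field \<Rightarrow> ('k, 'n::finite) cord ^ 'm::finite \<Rightarrow> _"
  by unfold_locales
    (auto simp: vscale_def vec_eq_iff Cord_inverse plus_cord.rep_eq algebra_simps intro!: cord_eqI)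

definition linear_on_cords ::
    "(('k::field, 'n::finite) cord ^ 'm::finite) set \<Rightarrow> (('k, 'n) cord ^ 'm \<Rightarrow> ('k, 'n) cord ^ 'p::finite) \<Rightarrow> bool" where
  "linear_on_cords U l \<longleftrightarrow> cords.subspace U \<and>
     (\<forall>x\<in>U. \<forall>y\<in>U. l (x + y) = l x + l y) \<and> (\<forall>a. \<forall>x\<in>U. l (vscale a x) = vscale a (l x))"

text \<open>The infimum of the empty set in \<^typ>\<open>enat\<close> is \<open>\<infinity>\<close>, so the zero series has order \<open>\<infinity>\<close>.\<close>

definition cord_order :: "('k::zero, 'n::finite) cord \<Rightarrow> enat" where
  "cord_order f = (INF \<alpha>\<in>{\<alpha>. coeff f \<alpha> \<noteq> 0}. enat (\<Sum>i\<in>UNIV. \<alpha> $ i))"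

definition ord :: "('k::zero, 'n::finite) cord ^ 'm::finite \<Rightarrow> enat" where
  "ord c = (MIN i. cord_order (c $ i))"

definition max_ideal :: "('k::comm_ring_1, 'n::finite) cord set" where
  "max_ideal = {f. coeff f 0 = 0}"

text \<open>Ideal powers and the submodule \<open>\<mm>\<^sup>l \<cdot> \<C>\<^sup>m\<close>, as sets of finite sums of products.\<close>

primrec max_ideal_power :: "nat \<Rightarrow> ('k::comm_ring_1, 'n::finite) cord set" where
  "max_ideal_power 0 = UNIV"
| "max_ideal_power (Suc l) =
     {\<Sum>j<N. a j * b j | (N::nat) a b. \<forall>j<N. a j \<in> max_ideal \<and> b j \<in> max_ideal_power l}"

definition madic :: "nat \<Rightarrow> (('k::comm_ring_1, 'n::finite) cord ^ 'm::finite) set" where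
  "madic l = {\<Sum>j<N. a j *s v j | (N::nat) a v. \<forall>j<N. a j \<in> max_ideal_power l}"

definition madic_nbhd0 :: "(('k::field, 'n::finite) cord ^ 'm::finite) set \<Rightarrow> bool" where
  "madic_nbhd0 U \<longleftrightarrow> cords.subspace U \<and> (\<exists>l. madic l \<subseteq> U)"

text \<open>
  \<open>('v \<Rightarrow>\<^sub>0 nat) \<Rightarrow>\<^sub>0 'k\<close> is the polynomial ring over \<open>'k\<close> in the variables \<open>'v\<close>; finite support
  ensures that each polynomial involves only finitely many variables.
\<close>

definition poly_eval :: "('v \<Rightarrow> 'k::comm_ring_1) \<Rightarrow> (('v \<Rightarrow>\<^sub>0 nat) \<Rightarrow>\<^sub>0 'k) \<Rightarrow> 'k" where
  "poly_eval x P = (\<Sum>\<mu>\<in>Poly_Mapping.keys P. Poly_Mapping.lookup P \<mu> *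
     (\<Prod>v\<in>Poly_Mapping.keys \<mu>. x v ^ Poly_Mapping.lookup \<mu> v))"

definition textile :: "(('k::field, 'n::finite) cord ^ 'm::finite \<Rightarrow> ('k, 'n) cord ^ 'p::finite) \<Rightarrow> bool" where
  "textile F \<longleftrightarrow> (\<forall>i \<alpha>. \<exists>P :: (('m \<times> (nat ^ 'n)) \<Rightarrow>\<^sub>0 nat) \<Rightarrow>\<^sub>0 'k.
     \<forall>c. coeff (F c $ i) \<alpha> = poly_eval (\<lambda>(j, \<beta>). coeff (c $ j) \<beta>) P)"

definition textile_on ::
    "(('k::field, 'n::finite) cord ^ 'm::finite) set \<Rightarrow> (('k, 'n) cord ^ 'm \<Rightarrow> ('k, 'n) cord ^ 'p::finite) \<Rightarrow> bool" where
  "textile_on U f \<longleftrightarrow> (\<exists>F. textile F \<and> (\<forall>c\<in>U. f c = F c))"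

definition contractive_on ::
    "(('k::field, 'n::finite) cord ^ 'm::finite) set \<Rightarrow> (('k, 'n) cord ^ 'm \<Rightarrow> ('k, 'n) cord ^ 'p::finite) \<Rightarrow> bool" where
  "contractive_on U g \<longleftrightarrow> (\<forall>a\<in>U. \<forall>b\<in>U. a \<noteq> b \<longrightarrow> ord (g a - g b) > ord (a - b))"

definition admits_inverse_on ::
    "(('k::field, 'n::finite) cord ^ 'm::finite) set \<Rightarrow> (('k, 'n) cord ^ 'm \<Rightarrow> ('k, 'n) cord ^ 'p::finite) \<Rightarrow> bool" where
  "admits_inverse_on U f \<longleftrightarrow> (\<exists>g. textile_on (f ` U) g \<and> g ` (f ` U) \<subseteq> U \<and>
     (\<forall>y\<in>f ` U. f (g y) = y) \<and> (\<forall>x\<in>U. g (f x) = x))"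

end

theory Submission
  imports "HOL-Computational_Algebra.Polynomial" Defs
begin

text \<open>
  On \<open>U\<close> we have \<open>l' \<circ> f = id + l' \<circ> h\<close>, and since \<open>l' \<circ> h\<close> is contractive the equation
  \<open>x = y - l' (h x)\<close> is solved by Picard iteration, whose \<open>k\<close>-th step is correct up to order \<open>k\<close>;
  hence each coefficient of the solution is a coefficient of a finite iterate. For the iterates to be
  textile, \<open>l'\<close> has to be textile although it is only assumed linear. This is linear duality: the
  entries of \<open>l x\<close> are finitely supported functionals of \<open>x\<close>, and by injectivity of \<open>l\<close> and
  linear compactness of \<open>U\<close> they span all finitely supported functionals on \<open>U\<close>.
\<close>

section \<open>Polynomial functions\<close>

definition monomial_fun :: "('v \<Rightarrow>\<^sub>0 nat) \<Rightarrow> ('v \<Rightarrow> 'k::comm_ring_1) \<Rightarrow> 'k" where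
  "monomial_fun \<mu> x = (\<Prod>v\<in>Poly_Mapping.keys \<mu>. x v ^ Poly_Mapping.lookup \<mu> v)"

text \<open>Indices off the support contribute exponent 0, so two monomials can be evaluated over
  one common finite index set.\<close>

lemma monomial_fun_superset:
  assumes "finite A" "Poly_Mapping.keys \<mu> \<subseteq> A"
  shows "monomial_fun \<mu> x = (\<Prod>v\<in>A. x v ^ Poly_Mapping.lookup \<mu> v)"
  unfolding monomial_fun_def
  by (rule prod.mono_neutral_left) (use assms in \<open>auto simp: in_keys_iff\<close>)

lemma monomial_fun_zero [simp]: "monomial_fun 0 x = 1"
  by (simp add: monomial_fun_def)

lemma monomial_fun_single [simp]: "monomial_fun (Poly_Mapping.single v k) x = x v ^ k"
  by (simp add: monomial_fun_superset[of "{v}"])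

lemma monomial_fun_add: "monomial_fun (\<mu> + \<nu>) x = monomial_fun \<mu> x * monomial_fun \<nu> x"
proof -
  let ?A = "Poly_Mapping.keys \<mu> \<union> Poly_Mapping.keys \<nu>"
  have "Poly_Mapping.keys (\<mu> + \<nu>) \<subseteq> ?A"
    by (rule Poly_Mapping.keys_add)
  then show ?thesis
    by (simp add: monomial_fun_superset[of ?A] lookup_add power_add prod.distrib)
qed

lemma monomial_fun_scale:
  "monomial_fun \<mu> (\<lambda>v. t * x v) =
     t ^ (\<Sum>v\<in>Poly_Mapping.keys \<mu>. Poly_Mapping.lookup \<mu> v) * monomial_fun \<mu> x"
  by (simp add: monomial_fun_def power_mult_distrib prod.distrib power_sum)

lemma poly_eval_superset:
  assumes "finite A" "Poly_Mapping.keys P \<subseteq> A"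
  shows "poly_eval x P = (\<Sum>\<mu>\<in>A. Poly_Mapping.lookup P \<mu> * monomial_fun \<mu> x)"
  unfolding poly_eval_def monomial_fun_def[symmetric]
  by (rule sum.mono_neutral_left) (use assms in \<open>auto simp: in_keys_iff\<close>)

lemma poly_eval_add: "poly_eval x (P + Q) = poly_eval x P + poly_eval x Q"
proof -
  let ?A = "Poly_Mapping.keys P \<union> Poly_Mapping.keys Q"
  have "Poly_Mapping.keys (P + Q) \<subseteq> ?A"
    by (rule Poly_Mapping.keys_add)
  then show ?thesis
    by (simp add: poly_eval_superset[of ?A] lookup_add algebra_simps sum.distrib)
qed

lemma poly_eval_single: "poly_eval x (Poly_Mapping.single \<mu> a) = a * monomial_fun \<mu> x"
  by (simp add: poly_eval_superset[of "{\<mu>}"])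

definition polynomial_fun :: "(('v \<Rightarrow> 'k::comm_ring_1) \<Rightarrow> 'k) \<Rightarrow> bool" where
  "polynomial_fun h \<longleftrightarrow> (\<exists>P. \<forall>x. h x = poly_eval x P)"

lemma polynomial_fun_monomial: "polynomial_fun (\<lambda>x. a * monomial_fun \<mu> x)"
  unfolding polynomial_fun_def by (metis poly_eval_single)

lemma polynomial_fun_const: "polynomial_fun (\<lambda>x. a)"
  using polynomial_fun_monomial[of a 0] by simp

lemma polynomial_fun_var: "polynomial_fun (\<lambda>x. x v)"
  using polynomial_fun_monomial[of 1 "Poly_Mapping.single v 1"] by simp

lemma polynomial_fun_add:
  assumes "polynomial_fun g" "polynomial_fun h"
  shows "polynomial_fun (\<lambda>x. g x + h x)"
  using assms unfolding polynomial_fun_def by (metis poly_eval_add)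

lemma polynomial_fun_sum:
  assumes "\<And>i. i \<in> A \<Longrightarrow> polynomial_fun (g i)"
  shows "polynomial_fun (\<lambda>x. \<Sum>i\<in>A. g i x)"
  using assms
  by (induction A rule: infinite_finite_induct)
    (simp_all add: polynomial_fun_const polynomial_fun_add)

lemma polynomial_fun_mult:
  assumes "polynomial_fun g" "polynomial_fun h"
  shows "polynomial_fun (\<lambda>x. g x * h x)"
proof -
  obtain P Q where P: "\<And>x. g x = poly_eval x P" and Q: "\<And>x. h x = poly_eval x Q"
    using assms unfolding polynomial_fun_def by blast
  have "g x * h x = (\<Sum>\<mu>\<in>Poly_Mapping.keys P. \<Sum>\<nu>\<in>Poly_Mapping.keys Q.
      Poly_Mapping.lookup P \<mu> * Poly_Mapping.lookup Q \<nu> * monomial_fun (\<mu> + \<nu>) x)" for x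
    unfolding P Q poly_eval_superset[OF finite_keys subset_refl] sum_product
    by (intro sum.cong refl) (simp add: monomial_fun_add algebra_simps)
  then show ?thesis
    by (simp add: polynomial_fun_sum polynomial_fun_monomial)
qed

lemma polynomial_fun_minus:
  assumes "polynomial_fun g" "polynomial_fun h"
  shows "polynomial_fun (\<lambda>x. g x - h x)"
  using polynomial_fun_add[OF assms(1) polynomial_fun_mult[OF polynomial_fun_const[of "-1"] assms(2)]]
  by simp

lemma polynomial_fun_power: "polynomial_fun g \<Longrightarrow> polynomial_fun (\<lambda>x. g x ^ k)"
  by (induction k) (simp_all add: polynomial_fun_const polynomial_fun_mult)

lemma polynomial_fun_prod:
  assumes "\<And>i. i \<in> A \<Longrightarrow> polynomial_fun (g i)"
  shows "polynomial_fun (\<lambda>x. \<Prod>i\<in>A. g i x)"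
  using assms
  by (induction A rule: infinite_finite_induct)
    (simp_all add: polynomial_fun_const polynomial_fun_mult)

text \<open>Only finitely many variables occur in the polynomial of \<open>h\<close>, so even with
  infinitely many substituted \<open>G x v\<close> the result is a finite polynomial
  expression.\<close>

lemma polynomial_fun_compose:
  assumes "polynomial_fun h" "\<And>v. polynomial_fun (\<lambda>x. G x v)"
  shows "polynomial_fun (\<lambda>x. h (G x))"
proof -
  obtain P where P: "\<And>x. h x = poly_eval x P"
    using assms(1) unfolding polynomial_fun_def by blast
  show ?thesis
    unfolding P poly_eval_def
    by (intro polynomial_fun_sum polynomial_fun_mult polynomial_fun_const polynomial_fun_prod
        polynomial_fun_power assms(2))
qed

text \<open>Over an infinite field the homogeneous components of a polynomial are determined by its
  values, so homogeneity of degree one along a line leaves only the linear part.\<close>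

lemma poly_eval_homogeneous_linear:
  fixes P :: "('v \<Rightarrow>\<^sub>0 nat) \<Rightarrow>\<^sub>0 'k::field_char_0"
  assumes hom: "\<And>t. poly_eval (\<lambda>v. t * x v) P = t * poly_eval x P"
  shows "poly_eval x P =
    (\<Sum>v | Poly_Mapping.lookup P (Poly_Mapping.single v 1) \<noteq> 0.
      Poly_Mapping.lookup P (Poly_Mapping.single v 1) * x v)"
proof -
  define deg :: "('v \<Rightarrow>\<^sub>0 nat) \<Rightarrow> nat"
    where "deg \<mu> = (\<Sum>v\<in>Poly_Mapping.keys \<mu>. Poly_Mapping.lookup \<mu> v)" for \<mu>
  \<comment> \<open>The restriction of \<open>P\<close> to the line through \<open>x\<close>, as a
    polynomial in the line parameter \<open>t\<close>.\<close>
  define p where "p = (\<Sum>\<mu>\<in>Poly_Mapping.keys P.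
    monom (Poly_Mapping.lookup P \<mu> * monomial_fun \<mu> x) (deg \<mu>))"
  have "poly p t = poly (monom (poly_eval x P) 1) t" for t
  proof -
    have "poly p t = poly_eval (\<lambda>v. t * x v) P"
      unfolding p_def poly_eval_superset[OF finite_keys subset_refl] monomial_fun_scale deg_def
      by (simp add: poly_sum poly_monom algebra_simps)
    then show ?thesis
      by (simp add: hom poly_monom)
  qed
  then have "p = monom (poly_eval x P) 1"
    by (metis poly_eq_poly_eq_iff ext)
  then have "poly_eval x P = Polynomial.coeff p 1"
    by simp
  also have "\<dots> = (\<Sum>\<mu>\<in>Poly_Mapping.keys P.
      if deg \<mu> = 1 then Poly_Mapping.lookup P \<mu> * monomial_fun \<mu> x else 0)"
    by (simp add: p_def coeff_sum)
  also have "\<dots> = (\<Sum>\<mu> | \<mu> \<in> Poly_Mapping.keys P \<and> deg \<mu> = 1.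
      Poly_Mapping.lookup P \<mu> * monomial_fun \<mu> x)"
    by (simp add: sum.If_cases Int_def)
  \<comment> \<open>A sum of naturals is 1 exactly when one summand is 1 and the others vanish, so
    degree one leaves single variables.\<close>
  also have "{\<mu> \<in> Poly_Mapping.keys P. deg \<mu> = 1} = (\<lambda>v. Poly_Mapping.single v 1) `
      {v. Poly_Mapping.lookup P (Poly_Mapping.single v 1) \<noteq> 0}" (is "?L = ?R")
  proof
    show "?L \<subseteq> ?R"
    proof
      fix \<mu> assume \<mu>: "\<mu> \<in> ?L"
      then obtain v where v: "v \<in> Poly_Mapping.keys \<mu>" "Poly_Mapping.lookup \<mu> v = 1"
        "\<And>w. w \<in> Poly_Mapping.keys \<mu> \<Longrightarrow> w \<noteq> v \<Longrightarrow> Poly_Mapping.lookup \<mu> w = 0"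
        using sum_eq_1_iff[OF finite_keys, of "Poly_Mapping.lookup \<mu>" \<mu>]
        unfolding deg_def by auto
      have "\<mu> = Poly_Mapping.single v 1"
        by (rule poly_mapping_eqI) (metis v lookup_single in_keys_iff when_def)
      then show "\<mu> \<in> ?R"
        using \<mu> by (auto simp: in_keys_iff)
    qed
    show "?R \<subseteq> ?L"
      by (auto simp: deg_def in_keys_iff)
  qed
  also have "(\<Sum>\<mu>\<in>?R. Poly_Mapping.lookup P \<mu> * monomial_fun \<mu> x) =
      (\<Sum>v | Poly_Mapping.lookup P (Poly_Mapping.single v 1) \<noteq> 0.
        Poly_Mapping.lookup P (Poly_Mapping.single v 1) * x v)"
    by (subst sum.reindex) (auto intro!: inj_onI dest: arg_cong[where f = Poly_Mapping.keys])
  finally show ?thesis .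
qed

section \<open>Entries of cords and textile maps\<close>

text \<open>Component and exponent are merged into one index, the variable type of the polynomials
  in \<open>textile\<close>.\<close>

definition entry :: "('k, 'n::finite) cord ^ 'm \<Rightarrow> 'm \<times> (nat ^ 'n) \<Rightarrow> 'k" where
  "entry c = (\<lambda>(j, \<beta>). coeff (c $ j) \<beta>)"

definition of_entries :: "('m \<times> (nat ^ 'n::finite) \<Rightarrow> 'k) \<Rightarrow> ('k, 'n) cord ^ 'm" where
  "of_entries x = (\<chi> j. Cord (\<lambda>\<beta>. x (j, \<beta>)))"

lemma entry_of_entries [simp]: "entry (of_entries x) = x"
  by (auto simp: entry_def of_entries_def Cord_inverse)

lemma entry_eqI: "(\<And>v. entry c v = entry d v) \<Longrightarrow> c = d"
  by (auto simp: entry_def vec_eq_iff intro!: cord_eqI)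

lemma entry_zero [simp]: "entry 0 v = 0"
  by (cases v) (simp add: entry_def zero_cord.rep_eq)

lemma entry_add [simp]: "entry (c + d) v = entry c v + entry d v"
  by (cases v) (simp add: entry_def plus_cord.rep_eq)

lemma entry_diff [simp]: "entry (c - d) v = entry c v - entry d v"
  by (cases v) (simp add: entry_def minus_cord.rep_eq)

lemma entry_vscale [simp]: "entry (vscale a c) v = a * entry c v"
  by (cases v) (simp add: entry_def vscale_def Cord_inverse)

lemma entry_sum [simp]: "entry (sum g A) v = (\<Sum>i\<in>A. entry (g i) v)"
  by (induction A rule: infinite_finite_induct) simp_all

lemma of_entries_entry [simp]: "of_entries (entry c) = c"
  by (rule entry_eqI) simp

lemma textile_iff:
  "textile F \<longleftrightarrow> (\<forall>v. polynomial_fun (\<lambda>x. entry (F (of_entries x)) v))"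
proof -
  have 1: "coeff (F c $ j) \<alpha> = entry (F c) (j, \<alpha>)" for c j \<alpha>
    by (simp add: entry_def)
  have 2: "(\<lambda>(j, \<beta>). coeff (c $ j) \<beta>) = entry c" for c :: "('a, 'b) cord ^ 'c"
    by (simp add: entry_def)
  have 3: "(\<forall>c. entry (F c) v = poly_eval (entry c) P) \<longleftrightarrow>
      (\<forall>x. entry (F (of_entries x)) v = poly_eval x P)" for v P
    by (metis of_entries_entry entry_of_entries)
  show ?thesis
    unfolding textile_def polynomial_fun_def split_paired_All 1 2 3 ..
qed

lemma textile_entry: "textile F \<Longrightarrow> polynomial_fun (\<lambda>x. entry (F (of_entries x)) v)"
  by (metis textile_iff)

lemma textile_zero: "textile (\<lambda>_. 0)"
  by (simp add: textile_iff polynomial_fun_const)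

lemma textile_add: "textile F \<Longrightarrow> textile G \<Longrightarrow> textile (\<lambda>c. F c + G c)"
  by (simp add: textile_iff polynomial_fun_add)

lemma textile_diff: "textile F \<Longrightarrow> textile G \<Longrightarrow> textile (\<lambda>c. F c - G c)"
  by (simp add: textile_iff polynomial_fun_minus)

lemma textile_compose:
  assumes "textile F" "textile G"
  shows "textile (\<lambda>c. F (G c))"
  unfolding textile_iff
proof
  fix v
  show "polynomial_fun (\<lambda>x. entry (F (G (of_entries x))) v)"
    using polynomial_fun_compose[OF textile_entry[OF assms(1), of v],
        of "\<lambda>x. entry (G (of_entries x))"] textile_entry[OF assms(2)]
    by simp
qed

section \<open>Order and the \<open>\<mm>\<close>-adic neighbourhoods\<close>

definition weight :: "'m \<times> (nat ^ 'n::finite) \<Rightarrow> nat" where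
  "weight v = (\<Sum>i\<in>UNIV. snd v $ i)"

text \<open>Finite lower bounds avoid computing the minimum or treating infinite order separately;
  later estimates use this form.\<close>

lemma ord_ge_iff:
  fixes c :: "('k::zero, 'n::finite) cord ^ 'm::finite"
  shows "enat k \<le> ord c \<longleftrightarrow> (\<forall>v. weight v < k \<longrightarrow> entry c v = 0)"
proof -
  have "enat k \<le> ord c \<longleftrightarrow> (\<forall>j. enat k \<le> cord_order (c $ j))"
    by (simp add: ord_def)
  also have "\<dots> \<longleftrightarrow> (\<forall>j \<alpha>. coeff (c $ j) \<alpha> \<noteq> 0 \<longrightarrow> k \<le> (\<Sum>i\<in>UNIV. \<alpha> $ i))"
    by (auto simp: cord_order_def le_INF_iff)
  also have "\<dots> \<longleftrightarrow> (\<forall>v. weight v < k \<longrightarrow> entry c v = 0)"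
    by (force simp: weight_def entry_def not_le[symmetric])
  finally show ?thesis .
qed

lemma finite_weight_less: "finite {v :: 'm::finite \<times> (nat ^ 'n::finite). weight v < k}"
proof -
  have "finite (vec_nth ` {\<alpha> :: nat ^ 'n. \<forall>i. \<alpha> $ i < k})"
    by (rule finite_subset[of _ "PiE UNIV (\<lambda>i. {..<k})"]) (auto intro: finite_PiE)
  then have "finite {\<alpha> :: nat ^ 'n. \<forall>i. \<alpha> $ i < k}"
    by (rule finite_imageD) (auto simp: inj_on_def vec_eq_iff)
  moreover have "snd v $ i \<le> weight v" for v :: "'m \<times> (nat ^ 'n)" and i
    unfolding weight_def by (rule member_le_sum) auto
  then have "{v :: 'm \<times> (nat ^ 'n). weight v < k} \<subseteq> UNIV \<times> {\<alpha>. \<forall>i. \<alpha> $ i < k}"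
    by (fastforce intro: le_less_trans)
  ultimately show ?thesis
    by (auto intro: finite_subset[OF _ finite_cartesian_product[OF finite]])
qed

definition cord_var :: "'n::finite \<Rightarrow> ('k::comm_ring_1, 'n) cord" where
  "cord_var i = Cord (\<lambda>\<alpha>. if \<alpha> = axis i 1 then 1 else 0)"

lemma coeff_sum: "coeff (sum g A) \<alpha> = (\<Sum>i\<in>A. coeff (g i) \<alpha>)"
  by (induction A rule: infinite_finite_induct) (simp_all add: zero_cord.rep_eq plus_cord.rep_eq)

text \<open>At most one pair of the Cauchy product survives. Subtraction of exponents truncates, so
  that pair exists only for nonzero \<open>\<gamma> $ i\<close>.\<close>

lemma coeff_cord_var_mult:
  "coeff (cord_var i * f) \<gamma> = (if \<gamma> $ i = 0 then 0 else coeff f (\<gamma> - axis i 1))"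
proof -
  have eq: "axis i 1 + \<beta> = \<gamma> \<longleftrightarrow> \<gamma> $ i \<noteq> 0 \<and> \<beta> = \<gamma> - axis i 1" for \<beta>
    by (auto simp: vec_eq_iff axis_def)
  have "coeff (cord_var i * f) \<gamma> =
      (\<Sum>p\<in>antidiag \<gamma>. if p = (axis i 1, \<gamma> - axis i 1) then coeff f (\<gamma> - axis i 1) else 0)"
    unfolding times_cord.rep_eq cord_var_def
  proof (rule sum.cong)
    fix p assume "p \<in> antidiag \<gamma>"
    then show "(case p of (\<beta>, \<beta>') \<Rightarrow> coeff (Cord (\<lambda>\<alpha>. if \<alpha> = axis i 1 then 1 else 0)) \<beta> * coeff f \<beta>') =
        (if p = (axis i 1, \<gamma> - axis i 1) then coeff f (\<gamma> - axis i 1) else 0)"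
      using eq[of "snd p"] by (auto simp: Cord_inverse antidiag_def simp del: One_nat_def)
  qed simp
  also have "\<dots> = (if \<gamma> $ i = 0 then 0 else coeff f (\<gamma> - axis i 1))"
    using eq[of "\<gamma> - axis i 1"] by (subst sum.delta[OF finite_antidiag]) (auto simp: antidiag_def simp del: One_nat_def)
  finally show ?thesis .
qed

text \<open>Every nonconstant monomial is divided by one chosen variable occurring in it.\<close>

lemma max_ideal_power_if_order:
  "(\<And>\<alpha>. (\<Sum>i\<in>UNIV. \<alpha> $ i) < l \<Longrightarrow> coeff f \<alpha> = 0) \<Longrightarrow>
    f \<in> (max_ideal_power l :: ('k::comm_ring_1, 'n::finite) cord set)"
proof (induction l arbitrary: f)
  case 0
  then show ?case by simp
next
  case (Suc l)
  \<comment> \<open>For \<open>\<alpha> = 0\<close> the choice is arbitrary, which is harmless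
    because \<open>f\<close> has no constant term.\<close>
  define \<sigma> :: "nat ^ 'n \<Rightarrow> 'n" where "\<sigma> \<alpha> = (SOME i. \<alpha> $ i \<noteq> 0)" for \<alpha>
  \<comment> \<open>Collects the monomials of \<open>f\<close> whose chosen variable is
    \<open>cord_var i\<close>, divided by it.\<close>
  define q where "q i = Cord (\<lambda>\<alpha>. if \<sigma> (\<alpha> + axis i 1) = i then coeff f (\<alpha> + axis i 1) else 0)" for i
  have q: "q i \<in> max_ideal_power l" for i
  proof (rule Suc.IH)
    fix \<alpha> :: "nat ^ 'n" assume "(\<Sum>i\<in>UNIV. \<alpha> $ i) < l"
    then have "(\<Sum>j\<in>UNIV. (\<alpha> + axis i 1) $ j) < Suc l"
      by (simp add: sum.distrib axis_def)
    then show "coeff (q i) \<alpha> = 0"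
      by (simp add: q_def Cord_inverse Suc.prems)
  qed
  have "f = (\<Sum>i\<in>UNIV. cord_var i * q i)"
  proof (rule cord_eqI)
    fix \<gamma> :: "nat ^ 'n"
    have "coeff (cord_var i * q i) \<gamma> = (if i = \<sigma> \<gamma> then coeff f \<gamma> else 0)" for i
    proof (cases "\<gamma> $ i = 0")
      case False
      then have "\<gamma> - axis i 1 + axis i 1 = \<gamma>"
        by (auto simp: vec_eq_iff axis_def)
      then show ?thesis
        using False by (auto simp: coeff_cord_var_mult q_def Cord_inverse simp del: One_nat_def)
    next
      case True
      have "coeff f \<gamma> = 0" if "i = \<sigma> \<gamma>"
      proof -
        have "\<gamma> $ j = 0" for j
          using that True someI[of "\<lambda>i. \<gamma> $ i \<noteq> 0" j] by (auto simp: \<sigma>_def)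
        then show ?thesis
          by (intro Suc.prems) simp
      qed
      then show ?thesis
        using True by (simp add: coeff_cord_var_mult)
    qed
    then show "coeff f \<gamma> = coeff (\<Sum>i\<in>UNIV. cord_var i * q i) \<gamma>"
      by (simp add: coeff_sum)
  qed
  \<comment> \<open>\<open>max_ideal_power\<close> sums over initial segments of the naturals, so
    the variables get numbered.\<close>
  moreover obtain e :: "nat \<Rightarrow> 'n" where e: "bij_betw e {..<CARD('n)} UNIV"
    using ex_bij_betw_nat_finite[of "UNIV :: 'n set"] by (auto simp: atLeast0LessThan)
  ultimately have "f = (\<Sum>j<CARD('n). cord_var (e j) * q (e j))"
    by (simp add: sum.reindex_bij_betw[OF e, where g = "\<lambda>i. cord_var i * q i"])
  moreover have "axis i 1 \<noteq> (0 :: nat ^ 'n)" for i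
    by simp
  then have "(cord_var i :: ('k, 'n) cord) \<in> max_ideal" for i :: 'n
    by (simp add: max_ideal_def cord_var_def Cord_inverse eq_commute[of 0])
  ultimately have "f = (\<Sum>j<CARD('n). cord_var (e j) * q (e j)) \<and>
      (\<forall>j<CARD('n). cord_var (e j) \<in> (max_ideal :: ('k, 'n) cord set) \<and> q (e j) \<in> max_ideal_power l)"
    using q by simp
  then show ?case
    unfolding max_ideal_power.simps by (intro CollectI exI)
qed

lemma madic_if_order:
  fixes c :: "('k::comm_ring_1, 'n::finite) cord ^ 'm::finite"
  assumes "enat l \<le> ord c"
  shows "c \<in> madic l"
proof -
  have mem: "c $ i \<in> max_ideal_power l" for i
  proof (rule max_ideal_power_if_order)
    fix \<alpha> :: "nat ^ 'n" assume "(\<Sum>i\<in>UNIV. \<alpha> $ i) < l"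
    then show "coeff (c $ i) \<alpha> = 0"
      using assms unfolding ord_ge_iff by (force simp: weight_def entry_def)
  qed
  obtain e :: "nat \<Rightarrow> 'm" where e: "bij_betw e {..<CARD('m)} UNIV"
    using ex_bij_betw_nat_finite[of "UNIV :: 'm set"] by (auto simp: atLeast0LessThan)
  have "c = (\<Sum>i\<in>UNIV. (c $ i) *s axis i 1)"
    by (auto simp: vec_eq_iff axis_def if_distrib cong: if_cong)
  then have "c = (\<Sum>j<CARD('m). (c $ e j) *s axis (e j) 1)"
    by (simp add: sum.reindex_bij_betw[OF e, where g = "\<lambda>i. (c $ i) *s axis i 1"])
  then show ?thesis
    unfolding madic_def
    by (intro CollectI exI[of _ "CARD('m)"] exI[of _ "\<lambda>j. c $ e j"] exI[of _ "\<lambda>j. axis (e j) 1"])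
      (simp add: mem)
qed

section \<open>The pairing with finitely supported families\<close>

definition unit_entry :: "'m \<times> (nat ^ 'n::finite) \<Rightarrow> ('k::field, 'n) cord ^ 'm" where
  "unit_entry v = of_entries (\<lambda>w. if w = v then 1 else 0)"

text \<open>Finitely supported families encode linear forms in finitely many coefficients. Sharing
  the type of cord vectors makes the \<open>cords\<close> linear algebra available for them.\<close>

definition finsupp :: "('k::field, 'n::finite) cord ^ 'm \<Rightarrow> bool" where
  "finsupp p \<longleftrightarrow> finite {v. entry p v \<noteq> 0}"

text \<open>Meant for \<open>finsupp p\<close>; over an infinite support the sum is 0 by
  default.\<close>

definition pairing :: "('k::field, 'n::finite) cord ^ 'm \<Rightarrow> ('k, 'n) cord ^ 'm \<Rightarrow> 'k" where
  "pairing p x = (\<Sum>v | entry p v \<noteq> 0. entry p v * entry x v)"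

lemma pairing_superset:
  assumes "finite A" "{v. entry p v \<noteq> 0} \<subseteq> A"
  shows "pairing p x = (\<Sum>v\<in>A. entry p v * entry x v)"
  unfolding pairing_def by (rule sum.mono_neutral_left) (use assms in auto)

lemma finsupp_zero: "finsupp 0"
  by (simp add: finsupp_def)

lemma finsupp_add: "finsupp p \<Longrightarrow> finsupp q \<Longrightarrow> finsupp (p + q)"
  unfolding finsupp_def by (rule finite_subset[of _ "{v. entry p v \<noteq> 0} \<union> {v. entry q v \<noteq> 0}"]) auto

lemma finsupp_vscale: "finsupp p \<Longrightarrow> finsupp (vscale a p)"
  unfolding finsupp_def by (rule finite_subset[of _ "{v. entry p v \<noteq> 0}"]) auto

lemma finsupp_unit_entry: "finsupp (unit_entry v)"
  by (simp add: finsupp_def unit_entry_def)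

lemma pairing_zero_left: "pairing 0 x = 0"
  by (simp add: pairing_def)

lemma pairing_add_left:
  assumes "finsupp p" "finsupp q"
  shows "pairing (p + q) x = pairing p x + pairing q x"
proof -
  let ?A = "{v. entry p v \<noteq> 0} \<union> {v. entry q v \<noteq> 0}"
  have "finite ?A"
    using assms by (simp add: finsupp_def)
  moreover have "{v. entry (p + q) v \<noteq> 0} \<subseteq> ?A" "{v. entry p v \<noteq> 0} \<subseteq> ?A" "{v. entry q v \<noteq> 0} \<subseteq> ?A"
    by auto
  ultimately show ?thesis
    by (simp only: pairing_superset[of ?A]) (simp add: algebra_simps sum.distrib)
qed

lemma pairing_vscale_left:
  assumes "finsupp p"
  shows "pairing (vscale a p) x = a * pairing p x"
proof -
  let ?A = "{v. entry p v \<noteq> 0}"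
  have "finite ?A"
    using assms by (simp add: finsupp_def)
  moreover have "{v. entry (vscale a p) v \<noteq> 0} \<subseteq> ?A"
    by auto
  ultimately show ?thesis
    by (simp only: pairing_superset[of ?A] subset_refl) (simp add: algebra_simps sum_distrib_left)
qed

lemma pairing_unit_entry: "pairing (unit_entry v) x = entry x v"
  by (subst pairing_superset[of "{v}"]) (auto simp: unit_entry_def)

lemma entry_sum_unit_entry:
  assumes "finite A"
  shows "entry (\<Sum>v\<in>A. vscale (a v) (unit_entry v)) w = (if w \<in> A then a w else 0)"
  using assms by (simp add: unit_entry_def if_distrib[where f = "\<lambda>x. _ * x"] cong: if_cong)

text \<open>The algebraic dual of a direct sum is the direct product: \<open>p\<close> is a finite
  combination of unit vectors, and the values of \<open>\<phi>\<close> on these may be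
  arbitrary.\<close>

lemma functional_eq_pairing:
  fixes \<phi> :: "('k::field, 'n::finite) cord ^ 'm::finite \<Rightarrow> 'k"
  assumes "Vector_Spaces.linear vscale (*) \<phi>" "finsupp p"
  shows "\<phi> p = pairing p (of_entries (\<lambda>v. \<phi> (unit_entry v)))"
proof -
  interpret \<phi>: Vector_Spaces.linear vscale "(*)" \<phi> by fact
  let ?A = "{v. entry p v \<noteq> 0}"
  have "p = (\<Sum>v\<in>?A. vscale (entry p v) (unit_entry v))"
    using assms(2) by (intro entry_eqI) (auto simp: entry_sum_unit_entry finsupp_def simp del: entry_sum)
  then have "\<phi> p = \<phi> (\<Sum>v\<in>?A. vscale (entry p v) (unit_entry v))"
    by simp
  then show ?thesis
    by (simp add: \<phi>.sum \<phi>.scale pairing_def)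
qed

text \<open>A basis of \<open>S\<close> stays independent after adding \<open>c\<close>, so the
  values 0 on it and 1 on \<open>c\<close> extend linearly.\<close>

lemma separating_functional:
  fixes S :: "(('k::field, 'n::finite) cord ^ 'm::finite) set"
  assumes "cords.subspace S" "c \<notin> S"
  obtains \<phi> where "Vector_Spaces.linear vscale (*) \<phi>" "\<And>s. s \<in> S \<Longrightarrow> \<phi> s = 0" "\<phi> c = (1 :: 'k)"
proof -
  interpret vp: vector_space_pair "vscale :: 'k \<Rightarrow> ('k, 'n) cord ^ 'm \<Rightarrow> _" "(*)"
    by unfold_locales (simp_all add: algebra_simps)
  obtain B where B: "B \<subseteq> S" "cords.independent B" "S \<subseteq> cords.span B"
    by (rule cords.maximal_independent_subset)
  have "cords.span B \<subseteq> S"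
    using B(1) assms(1) by (rule cords.span_minimal)
  then have c: "c \<notin> cords.span B"
    using assms(2) by blast
  then have "cords.independent (insert c B)"
    using B(2) by (rule cords.independent_insertI)
  from vp.linear_independent_extend[OF this, of "\<lambda>b. if b = c then 1 else 0"]
  obtain \<phi> where \<phi>: "Vector_Spaces.linear vscale (*) \<phi>"
    "\<And>b. b \<in> insert c B \<Longrightarrow> \<phi> b = (if b = c then 1 else 0)"
    by blast
  have "\<phi> s = 0" if "s \<in> S" for s
  proof (rule vp.linear_eq_0_on_span[OF \<phi>(1)])
    show "s \<in> cords.span B" using that B(3) by blast
    show "\<phi> b = 0" if "b \<in> B" for b
      using that c \<phi>(2) cords.span_base[of b B] by auto
  qed
  then show ?thesis
    using that \<phi> by simp
qed

text \<open>A subspace containing some \<open>\<mm>\<^sup>l \<cdot> \<C>\<^sup>m\<close> is cut out by finitely supported functionals.\<close>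

lemma madic_nbhd0_memI:
  fixes U :: "(('k::field, 'n::finite) cord ^ 'm::finite) set"
  assumes U: "madic_nbhd0 U"
    and u: "\<And>p. finsupp p \<Longrightarrow> (\<And>x. x \<in> U \<Longrightarrow> pairing p x = 0) \<Longrightarrow> pairing p u = 0"
  shows "u \<in> U"
proof (rule ccontr)
  assume "u \<notin> U"
  obtain L where L: "madic L \<subseteq> U" and sub: "cords.subspace U"
    using U unfolding madic_nbhd0_def by blast
  obtain \<psi> where lin: "Vector_Spaces.linear vscale (*) \<psi>"
    and \<psi>: "\<And>x. x \<in> U \<Longrightarrow> \<psi> x = 0" "\<psi> u = 1"
    using separating_functional[OF sub \<open>u \<notin> U\<close>] by blast
  interpret \<psi>: Vector_Spaces.linear vscale "(*)" \<psi> by fact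
  let ?A = "{v :: 'm \<times> (nat ^ 'n). weight v < L}"
  note fin = finite_weight_less[of L, where ?'m = 'm and ?'n = 'n]
  \<comment> \<open>Vanishing on \<open>madic L\<close>, \<open>\<psi>\<close> sees only the
    finitely many entries of weight below \<open>L\<close>, so it is itself a pairing.\<close>
  define p where "p = of_entries (\<lambda>v. if weight v < L then \<psi> (unit_entry v) else 0)"
  have pairing: "pairing p x = \<psi> x" for x
  proof -
    let ?y = "\<Sum>v\<in>?A. vscale (entry x v) (unit_entry v)"
    have "enat L \<le> ord (x - ?y)"
      unfolding ord_ge_iff by (simp add: entry_sum_unit_entry fin del: entry_sum)
    then have "\<psi> (x - ?y) = 0"
      using \<psi>(1) L madic_if_order by blast
    then have "\<psi> x = (\<Sum>v\<in>?A. entry x v * \<psi> (unit_entry v))"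
      by (simp add: \<psi>.diff \<psi>.sum \<psi>.scale)
    also have "\<dots> = pairing p x"
      by (subst pairing_superset[OF fin]) (auto simp: p_def mult.commute intro: sum.cong split: if_splits)
    finally show ?thesis by simp
  qed
  have "finsupp p"
    unfolding finsupp_def by (rule finite_subset[OF _ fin]) (auto simp: p_def)
  then have "pairing p u = 0"
    by (rule u) (simp add: pairing \<psi>(1))
  then show False
    by (simp add: pairing \<psi>(2))
qed

section \<open>Inverting linear textile maps\<close>

text \<open>Linearity makes the polynomial of an entry homogeneous of degree one on each line in
  \<open>U\<close>, so there only its linear coefficients matter; they do not depend on
  \<open>x\<close>.\<close>

lemma linear_textile_entry:
  fixes l :: "('k::field_char_0, 'n::finite) cord ^ 'm::finite \<Rightarrow> ('k, 'n) cord ^ 'p::finite"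
  assumes "linear_on_cords U l" "textile_on U l"
  obtains p where "finsupp p" "\<And>x. x \<in> U \<Longrightarrow> entry (l x) v = pairing p x"
proof -
  obtain F where F: "textile F" "\<And>c. c \<in> U \<Longrightarrow> l c = F c"
    using assms(2) unfolding textile_on_def by blast
  obtain P where P: "\<And>x. entry (F (of_entries x)) v = poly_eval x P"
    using textile_entry[OF F(1)] unfolding polynomial_fun_def by blast
  have l: "entry (l x) v = poly_eval (entry x) P" if "x \<in> U" for x
    using P[of "entry x"] F(2)[OF that] by simp
  define p :: "('k, 'n) cord ^ 'm"
    where "p = of_entries (\<lambda>w. Poly_Mapping.lookup P (Poly_Mapping.single w 1))"
  have "inj (\<lambda>w :: 'm \<times> (nat ^ 'n). Poly_Mapping.single w (1 :: nat))"
    by (auto intro!: injI dest: arg_cong[where f = Poly_Mapping.keys])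
  then have "finsupp p"
    using finite_vimageI[OF finite_keys[of P]]
    unfolding finsupp_def by (simp add: p_def vimage_def in_keys_iff)
  moreover have "entry (l x) v = pairing p x" if x: "x \<in> U" for x
  proof -
    have "poly_eval (\<lambda>w. t * entry x w) P = t * poly_eval (entry x) P" for t
    proof -
      have "vscale t x \<in> U" "l (vscale t x) = vscale t (l x)"
        using assms(1) x unfolding linear_on_cords_def by (auto intro: cords.subspace_scale)
      then show ?thesis
        using l[of "vscale t x"] l[OF x] by (simp add: entry_vscale[abs_def])
    qed
    then show ?thesis
      using poly_eval_homogeneous_linear[of "entry x" P] by (simp add: l[OF x] pairing_def p_def)
  qed
  ultimately show ?thesis
    using that by blast
qed

text \<open>If an entry were not a finite combination of the entries of \<open>l x\<close>, a functional separating
  it from these combinations would be the pairing with a vector of \<open>U\<close> in the kernel of \<open>l\<close>.\<close>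

lemma linear_textile_inverse_entry:
  fixes l :: "('k::field_char_0, 'n::finite) cord ^ 'm::finite \<Rightarrow> ('k, 'n) cord ^ 'p::finite"
  assumes U: "madic_nbhd0 U" and lin: "linear_on_cords U l" and tex: "textile_on U l"
    and inj: "\<And>x. x \<in> U \<Longrightarrow> l x = 0 \<Longrightarrow> x = 0"
  obtains q where "\<And>x. x \<in> U \<Longrightarrow> entry x v = pairing q (l x)"
proof -
  \<comment> \<open>The linear forms that factor through \<open>l\<close> on \<open>U\<close>. Forms
    vanishing on \<open>U\<close> are included, with \<open>q = 0\<close>; this later forces
    \<open>u\<close> into \<open>U\<close>.\<close>
  define T where "T = {p. finsupp p \<and> (\<exists>q. finsupp q \<and> (\<forall>x\<in>U. pairing p x = pairing q (l x)))}"
  have "cords.subspace T"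
  proof (rule cords.subspaceI)
    show "0 \<in> T"
      by (auto simp: T_def finsupp_zero pairing_zero_left intro!: exI[of _ 0])
    fix p p' assume "p \<in> T" "p' \<in> T"
    then obtain q q' where "finsupp p" "finsupp q" "\<forall>x\<in>U. pairing p x = pairing q (l x)"
      "finsupp p'" "finsupp q'" "\<forall>x\<in>U. pairing p' x = pairing q' (l x)"
      unfolding T_def by blast
    then show "p + p' \<in> T"
      unfolding T_def by (auto simp: finsupp_add pairing_add_left intro!: exI[of _ "q + q'"])
  next
    fix a p assume "p \<in> T"
    then obtain q where "finsupp p" "finsupp q" "\<forall>x\<in>U. pairing p x = pairing q (l x)"
      unfolding T_def by blast
    then show "vscale a p \<in> T"
      unfolding T_def by (auto simp: finsupp_vscale pairing_vscale_left intro!: exI[of _ "vscale a q"])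
  qed
  moreover have "unit_entry v \<in> T"
  proof (rule ccontr)
    assume "unit_entry v \<notin> T"
    then obtain \<phi> where \<phi>: "Vector_Spaces.linear vscale (*) \<phi>"
      "\<And>p. p \<in> T \<Longrightarrow> \<phi> p = 0" "\<phi> (unit_entry v) = 1"
      using separating_functional[OF \<open>cords.subspace T\<close>] by blast
    define u where "u = of_entries (\<lambda>v. \<phi> (unit_entry v))"
    have T: "pairing p u = 0" if "p \<in> T" for p
      using that \<phi>(2)[OF that] functional_eq_pairing[OF \<phi>(1), of p]
      by (simp add: u_def T_def)
    have "u \<in> U"
    proof (rule madic_nbhd0_memI[OF U])
      fix p assume "finsupp p" "\<And>x. x \<in> U \<Longrightarrow> pairing p x = 0"
      then have "p \<in> T"
        by (auto simp: T_def finsupp_zero pairing_zero_left intro!: exI[of _ 0])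
      then show "pairing p u = 0"
        by (rule T)
    qed
    moreover have "l u = 0"
    proof (rule entry_eqI)
      fix w
      obtain p where p: "finsupp p" "\<And>x. x \<in> U \<Longrightarrow> entry (l x) w = pairing p x"
        using linear_textile_entry[OF lin tex] by blast
      \<comment> \<open>Entry \<open>w\<close> of \<open>l x\<close> factors through
        \<open>l\<close> trivially, so its form is annihilated by \<open>u\<close>.\<close>
      then have "p \<in> T"
        by (auto simp: T_def pairing_unit_entry finsupp_unit_entry intro!: exI[of _ "unit_entry w"])
      then show "entry (l u) w = entry 0 w"
        using p(2)[OF \<open>u \<in> U\<close>] T by simp
    qed
    ultimately have "u = 0"
      by (rule inj)
    moreover have "entry u v = 1"
      by (simp add: u_def \<phi>(3))
    ultimately show False
      by simp
  qed
  ultimately show ?thesis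
    using that unfolding T_def by (auto simp: pairing_unit_entry)
qed

text \<open>The forms found for the single entries assemble to a map on the whole target space, as
  \<open>textile\<close> demands.\<close>

lemma linear_textile_left_inverse:
  fixes l :: "('k::field_char_0, 'n::finite) cord ^ 'm::finite \<Rightarrow> ('k, 'n) cord ^ 'p::finite"
  assumes "madic_nbhd0 U" "linear_on_cords U l" "textile_on U l"
    and "\<And>x. x \<in> U \<Longrightarrow> l x = 0 \<Longrightarrow> x = 0"
  obtains L where "textile L" "\<And>x. x \<in> U \<Longrightarrow> L (l x) = x"
proof -
  have "\<exists>q. \<forall>x\<in>U. entry x v = pairing q (l x)" for v
    using linear_textile_inverse_entry[OF assms] by metis
  then obtain q where q: "\<And>v x. x \<in> U \<Longrightarrow> entry x v = pairing (q v) (l x)"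
    by metis
  define L where "L z = of_entries (\<lambda>v. pairing (q v) z)" for z
  have "textile L"
    \<comment> \<open>An infinite support would make the sum 0, so the entries are polynomial
      whichever \<open>q v\<close> was chosen.\<close>
    unfolding textile_iff L_def pairing_def
    by (auto intro!: polynomial_fun_sum polynomial_fun_mult polynomial_fun_const polynomial_fun_var)
  moreover have "L (l x) = x" if "x \<in> U" for x
    by (rule entry_eqI) (simp add: L_def q[OF that])
  ultimately show ?thesis
    using that by blast
qed

section \<open>Inversion of a contractive perturbation by Picard iteration\<close>

theorem theorem1p1:
  fixes U W :: "(('k::field_char_0, 'n::finite) cord ^ 'm::finite) set"
    and f l h l' :: "('k, 'n) cord ^ 'm \<Rightarrow> ('k, 'n) cord ^ 'm"
  assumes "madic_nbhd0 U"
    and "textile_on U f"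
    and "f 0 = 0"
    and "madic_nbhd0 W"
    and "\<forall>x\<in>U. f x = l x + h x"
    and "f ` U \<subseteq> W"
    and "l ` U \<subseteq> W"
    and "linear_on_cords U l"
    and "textile_on U l"
    and "l' ` W \<subseteq> U"
    and "linear_on_cords W l'"
    and "\<forall>y\<in>W. l (l' y) = y"
    and "\<forall>x\<in>U. l' (l x) = x"
    and "contractive_on U (l' \<circ> h)"
  shows "admits_inverse_on U f"
proof -
  have subU: "cords.subspace U" and subW: "cords.subspace W"
    using assms(1,4) by (auto simp: madic_nbhd0_def)
  have "l 0 = 0"
    using assms(8) cords.subspace_0[OF subU] unfolding linear_on_cords_def
    by (metis add_cancel_right_right)
  then have l0: "x = 0" if "x \<in> U" "l x = 0" for x
    using assms(13) that cords.subspace_0[OF subU] by metis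
  obtain L where L: "textile L" "\<And>x. x \<in> U \<Longrightarrow> L (l x) = x"
    using linear_textile_left_inverse[OF assms(1,8,9) l0] by blast
  obtain F where F: "textile F" "\<And>x. x \<in> U \<Longrightarrow> f x = F x"
    using assms(2) unfolding textile_on_def by blast
  \<comment> \<open>Every \<open>y\<close> in \<open>W\<close> is \<open>l (l' y)\<close>, so the
    textile \<open>L\<close> can stand in for \<open>l'\<close>.\<close>
  have LW: "L y = l' y" "L y \<in> U" if "y \<in> W" for y
    using L(2)[of "l' y"] assms(10,12) that by auto
  \<comment> \<open>Both \<open>f x\<close> and \<open>l x\<close> lie in \<open>W\<close>, hence so
    does \<open>h x\<close>, and linearity of \<open>l'\<close> on \<open>W\<close> splits
    \<open>l' (f x)\<close>.\<close>
  have fU: "L (F x) = x + l' (h x)" "L (F x) \<in> U" if x: "x \<in> U" for x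
  proof -
    have W: "l x \<in> W" "f x \<in> W"
      using assms(6,7) x by auto
    moreover have "h x = f x - l x"
      using assms(5) x by simp
    ultimately have "h x \<in> W"
      using cords.subspace_diff[OF subW] by simp
    then have "l' (f x) = l' (l x) + l' (h x)"
      using W(1) assms(5,11) x unfolding linear_on_cords_def by simp
    then show "L (F x) = x + l' (h x)" "L (F x) \<in> U"
      using LW[OF W(2)] F(2)[OF x] assms(13) x by auto
  qed
  text \<open>Picard iteration for the equation \<open>x = L z - l' (h x)\<close>.\<close>
  define X where "X k z = ((\<lambda>x. L z + x - L (F x)) ^^ k) 0" for k z
  have X_Suc: "X (Suc k) z = L z + X k z - L (F (X k z))" for k z
    by (simp add: X_def)
  \<comment> \<open>Writing \<open>- l' (h x)\<close> as \<open>x - L (F x)\<close> pays off here: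
    \<open>L\<close> and \<open>F\<close> are textile on the whole space.\<close>
  have X_textile: "textile (X k)" for k
  proof (induction k)
    case 0
    then show ?case by (simp add: X_def textile_zero)
  next
    case (Suc k)
    have "textile (\<lambda>z. L z + X k z - L (F (X k z)))"
      by (intro textile_diff textile_add textile_compose[OF L(1)] textile_compose[OF F(1)] Suc L(1))
    then show ?case by (simp add: X_Suc[abs_def])
  qed
  \<comment> \<open>Contractivity concerns points of \<open>U\<close> only, so membership in
    \<open>U\<close> is carried through the induction.\<close>
  have approx: "X k (f x) \<in> U \<and> enat k \<le> ord (x - X k (f x))" if x: "x \<in> U" for k x
  proof (induction k)
    case 0
    show ?case
      by (simp add: X_def cords.subspace_0[OF subU] enat_0)
  next
    case (Suc k)
    let ?y = "X k (f x)"
    have y: "?y \<in> U" "enat k \<le> ord (x - ?y)"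
      using Suc.IH by auto
    have "X (Suc k) (f x) = L (F x) + ?y - L (F ?y)"
      by (simp add: X_Suc F(2)[OF x])
    then have "X (Suc k) (f x) \<in> U"
      using cords.subspace_diff[OF subU cords.subspace_add[OF subU]] fU(2) x y(1) by simp
    \<comment> \<open>For \<open>z = f x\<close> the point \<open>x\<close> is fixed by the
      iteration step, so the new error is a difference of values of \<open>l' \<circ> h\<close>;
      contractivity then improves the order bound by one.\<close>
    moreover have "x - X (Suc k) (f x) = l' (h ?y) - l' (h x)"
      by (simp add: X_Suc F(2)[OF x, symmetric] fU(1)[OF y(1)])
        (simp add: F(2)[OF x] fU(1)[OF x])
    moreover have "enat (Suc k) \<le> ord (l' (h ?y) - l' (h x))"
    proof (cases "?y = x")
      case True
      then show ?thesis
        by (simp add: ord_ge_iff)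
    next
      case False
      then have "ord (?y - x) < ord (l' (h ?y) - l' (h x))"
        using assms(14) x y(1) unfolding contractive_on_def by simp
      moreover have "enat k \<le> ord (?y - x)"
        using y(2) by (auto simp: ord_ge_iff)
      ultimately show ?thesis
        by (metis Suc_ile_eq le_less_trans)
    qed
    ultimately show ?case
      by simp
  qed
  \<comment> \<open>Agreement to order \<open>Suc (weight v)\<close> covers the entry
    \<open>v\<close> itself. Each entry of \<open>G\<close> is read off one finite iterate, hence
    polynomial.\<close>
  define G where "G z = of_entries (\<lambda>v. entry (X (Suc (weight v)) z) v)" for z
  have "textile G"
    using X_textile by (simp add: textile_iff G_def)
  moreover have G: "G (f x) = x" if "x \<in> U" for x
  proof (rule entry_eqI)
    fix v
    show "entry (G (f x)) v = entry x v"
      using approx[OF that, of "Suc (weight v)"] by (auto simp: G_def ord_ge_iff simp del: split_paired_All)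
  qed
  \<comment> \<open>Points of the image have the form \<open>f x\<close> with \<open>x\<close> in
    \<open>U\<close>, so \<open>G (f x) = x\<close> also gives \<open>f (G y) = y\<close>
    there.\<close>
  ultimately show ?thesis
    unfolding admits_inverse_on_def textile_on_def by (intro exI[of _ G]) auto
qed

end
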